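(* Let $Y\in\mathcal{U}$. For $k,l\in\{1,\dots,n\}$, define $\Theta_{k,l}^{Y,Z}:=\{\theta\in\mathbb{S}^{d-1}:\tau_Z^\theta\circ(\tau_Y^\theta)^{-1}(k)=l\}$ and $S_{k,l}^{Y,Z}:=d\int_{\Theta_{k,l}^{Y,Z}}\theta\theta^T\,d\sigma(\theta)$. Then $Y$ is a critical point of $\mathcal{E}$ if and only if $$\forall k\in\{1,\dots,n\},\qquad y_k=\sum_{l=1}^nS_{k,l}^{Y,Z}z_l.$$
   Context: Let $n,d\ge1$. A matrix $Y\in\mathbb{R}^{n\times d}$ is written $Y=(y_1,\dots,y_n)^T$ with rows $y_k\in\mathbb{R}^d$, and $\gamma_Y:=\frac1n\sum_{k=1}^n\delta_{y_k}$. Fix $Z\in\mathbb{R}^{n\times d}$. $\sigma$ is the uniform probability measure on the unit sphere $\mathbb{S}^{d-1}$, $P_\theta(x)=\theta^Tx$, $\#$ is push-forward, $\mathrm{W}_2$ is the 2-Wasserstein distance, and $\mathcal{E}(Y):=\int_{\mathbb{S}^{d-1}}\mathrm{W}_2^2(P_\theta\#\gamma_Y,P_\theta\#\gamma_Z)\,d\sigma(\theta)$. $\mathcal{U}:=\{(x_1,\dots,x_n)^T\in\mathbb{R}^{n\times d}:x_i\neq x_j\ \forall i\ne j\}$. For $\theta\in\mathbb{S}^{d-1}$ and $X\in\mathbb{R}^{n\times d}$, $\tau_X^\theta$ is any permutation of $\{1,\dots,n\}$ such that $\theta^Tx_{\tau_X^\theta(1)}\le\dots\le\theta^Tx_{\tau_X^\theta(n)}$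 (chosen measurably in $\theta$ when ambiguous). A critical point of $\mathcal{E}$ is a point where $\mathcal{E}$ is differentiable with $\nabla\mathcal{E}=0$. *)

theory Defs
  imports "HOL-Probability.Probability"
begin

text \<open>
  A matrix in \<open>\<real>\<^sup>n\<^sup>\<times>\<^sup>d\<close> is an element of \<open>real^'d^'n\<close> with \<open>n = CARD('n)\<close> and
  \<open>d = CARD('d)\<close>; its row \<open>y\<^sub>k\<close> is \<open>Y $ k\<close>. The inner product of this type is the
  Frobenius inner product.
\<close>

text \<open>
  The uniform probability measure on the unit sphere, as the normalised cone measure
  \<open>A \<mapsto> vol {t x | 0 < t \<le> 1, x \<in> A} / vol (cball 0 1)\<close>. The point \<open>0\<close>, which
  \<open>sgn\<close> does not map to the sphere, is a null set.
\<close>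

definition sphere_uniform :: "'a::euclidean_space measure" where
  "sphere_uniform =
     restrict_space (distr (uniform_measure lborel (cball 0 1)) borel sgn) (sphere 0 1)"

definition empirical_measure :: "real^'d^'n \<Rightarrow> (real^'d) measure" where
  "empirical_measure Y = distr (uniform_count_measure UNIV) borel (\<lambda>k. Y $ k)"

definition couplings :: "'a measure \<Rightarrow> 'a measure \<Rightarrow> ('a \<times> 'a) measure set" where
  "couplings \<mu> \<nu> = {\<pi>. prob_space \<pi> \<and> sets \<pi> = sets (\<mu> \<Otimes>\<^sub>M \<nu>) \<and>
                        distr \<pi> \<mu> fst = \<mu> \<and> distr \<pi> \<nu> snd = \<nu>}"

text \<open>Meaningful for Borel probability measures with finite second moment.\<close>

definition W2 :: "'a::metric_space measure \<Rightarrow> 'a measure \<Rightarrow> real" where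
  "W2 \<mu> \<nu> = sqrt (enn2real
     (INF \<pi>\<in>couplings \<mu> \<nu>. \<integral>\<^sup>+ (x, y). ennreal ((dist x y)\<^sup>2) \<partial>\<pi>))"

definition line_proj :: "real^'d \<Rightarrow> real^'d \<Rightarrow> real" where
  "line_proj \<theta> x = \<theta> \<bullet> x"

text \<open>The squared sliced 2-Wasserstein distance to \<open>\<gamma>\<^sub>Z\<close>.\<close>

definition SW_energy :: "real^'d^'n \<Rightarrow> real^'d^'n \<Rightarrow> real" where
  "SW_energy Z Y =
     (\<integral>\<theta>. (W2 (distr (empirical_measure Y) borel (line_proj \<theta>))
              (distr (empirical_measure Z) borel (line_proj \<theta>)))\<^sup>2 \<partial>sphere_uniform)"

definition distinct_rows :: "(real^'d^'n) set" where
  "distinct_rows = {X. \<forall>i j. i \<noteq> j \<longrightarrow> X $ i \<noteq> X $ j}"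

text \<open>
  \<open>t \<theta>\<close> lists the row indices of \<open>X\<close>, in positions \<open>1, \<dots>, n\<close>, by increasing
  projection onto \<open>\<theta>\<close>; ties are broken arbitrarily but measurably in \<open>\<theta>\<close>. As the rows
  are indexed by an arbitrary finite type, \<open>t \<theta>\<close> is a bijection from \<open>{1..n}\<close> onto that
  type; its values at other positions are irrelevant.
\<close>

definition measurable_sorting :: "real^'d^'n \<Rightarrow> (real^'d \<Rightarrow> nat \<Rightarrow> 'n) \<Rightarrow> bool" where
  "measurable_sorting X t \<longleftrightarrow>
     (\<forall>\<theta>\<in>sphere 0 1. bij_betw (t \<theta>) {1..CARD('n)} UNIV \<and>
        (\<forall>i\<in>{1..CARD('n)}. \<forall>j\<in>{1..CARD('n)}. i \<le> j \<longrightarrow>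
           line_proj \<theta> (X $ t \<theta> i) \<le> line_proj \<theta> (X $ t \<theta> j))) \<and>
     (\<forall>i\<in>{1..CARD('n)}. (\<lambda>\<theta>. t \<theta> i) \<in> measurable sphere_uniform (count_space UNIV))"

text \<open>
  In the next two definitions \<open>s\<close> and \<open>t\<close> are the sorting families of \<open>Y\<close> and of \<open>Z\<close>.
\<close>

definition match_region ::
  "(real^'d \<Rightarrow> nat \<Rightarrow> 'n::finite) \<Rightarrow> (real^'d \<Rightarrow> nat \<Rightarrow> 'n) \<Rightarrow> 'n \<Rightarrow> 'n \<Rightarrow> (real^'d) set" where
  "match_region s t k l =
     {\<theta>\<in>sphere 0 1. (t \<theta> \<circ> inv_into {1..CARD('n)} (s \<theta>)) k = l}"

definition match_matrix ::
  "(real^'d \<Rightarrow> nat \<Rightarrow> 'n::finite) \<Rightarrow> (real^'d \<Rightarrow> nat \<Rightarrow> 'n) \<Rightarrow> 'n \<Rightarrow> 'n \<Rightarrow> real^'d^'d" where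
  "match_matrix s t k l = real CARD('d) *\<^sub>R
     (LINT \<theta>:match_region s t k l|sphere_uniform. (\<chi> i j. \<theta> $ i * \<theta> $ j))"

definition critical_point :: "('a::real_inner \<Rightarrow> real) \<Rightarrow> 'a \<Rightarrow> bool" where
  "critical_point f x \<longleftrightarrow> GDERIV f x :> 0"

lemma emeasure_empirical_measure:
  fixes Y :: "real^'d^'n"
  assumes "A \<in> sets borel"
  shows "emeasure (empirical_measure Y) A =
    (\<Sum>k\<in>UNIV. emeasure (return borel (Y $ k)) A) / of_nat CARD('n)"
proof -
  have m: "(\<lambda>k. Y $ k) \<in> measurable (uniform_count_measure UNIV) borel"
    by (rule measurableI) (simp_all add: space_uniform_count_measure sets_uniform_count_measure)
  have "emeasure (empirical_measure Y) A = emeasure (uniform_count_measure UNIV) {k. Y $ k \<in> A}"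
    using assms m unfolding empirical_measure_def
    by (simp add: emeasure_distr vimage_def space_uniform_count_measure)
  also have "\<dots> = ennreal (real (card {k. Y $ k \<in> A}) / real CARD('n))"
    by (simp add: emeasure_uniform_count_measure)
  also have "\<dots> = of_nat (card {k. Y $ k \<in> A}) / of_nat CARD('n)"
    by (simp add: divide_ennreal[symmetric] ennreal_of_nat_eq_real_of_nat)
  finally have "emeasure (empirical_measure Y) A = of_nat (card {k. Y $ k \<in> A}) / of_nat CARD('n)" .
  moreover have "(\<Sum>k\<in>UNIV. emeasure (return borel (Y $ k)) A) =
      (\<Sum>k\<in>UNIV. if Y $ k \<in> A then 1 else 0)"
    using assms by (intro sum.cong) (simp_all add: indicator_def)
  moreover have "\<dots> = of_nat (card {k. Y $ k \<in> A})"
    by (subst sum.If_cases) simp_all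
  ultimately show ?thesis by simp
qed

lemma space_sphere_uniform: "space (sphere_uniform :: 'a::euclidean_space measure) = sphere 0 1"
  by (simp add: sphere_uniform_def space_restrict_space)

lemma sets_sphere_uniform:
  "sets (sphere_uniform :: 'a::euclidean_space measure) = sets (restrict_space borel (sphere 0 1))"
  by (simp add: sphere_uniform_def sets_restrict_space)

lemma emeasure_sphere_uniform:
  fixes A :: "'a::euclidean_space set"
  assumes "A \<in> sets borel" "A \<subseteq> sphere 0 1"
  shows "emeasure sphere_uniform A =
    emeasure lborel {x \<in> cball 0 1. sgn x \<in> A} / emeasure lborel (cball 0 1 :: 'a set)"
proof -
  have m: "sgn \<in> borel_measurable (borel :: 'a measure)"
    unfolding sgn_div_norm by measurable
  have "emeasure sphere_uniform A =
      emeasure (uniform_measure lborel (cball 0 1 :: 'a set)) (sgn -` A)"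
    using assms m unfolding sphere_uniform_def
    by (subst emeasure_restrict_space) (auto simp: emeasure_distr)
  also have "\<dots> = emeasure lborel (cball 0 1 \<inter> sgn -` A) / emeasure lborel (cball 0 1 :: 'a set)"
    using measurable_sets[OF m assms(1)] by simp
  also have "cball 0 1 \<inter> sgn -` A = {x \<in> cball 0 1. sgn x \<in> A}"
    by auto
  finally show ?thesis .
qed

lemma prob_space_sphere_uniform: "prob_space (sphere_uniform :: 'a::euclidean_space measure)"
proof (rule prob_spaceI)
  let ?B = "cball 0 1 :: 'a set"
  have B: "{x \<in> ?B. sgn x \<in> sphere 0 1} = ?B - {0}"
    by (auto simp: norm_sgn)
  have diff: "emeasure lborel (?B - {0}) = emeasure lborel ?B"
    by (rule emeasure_Diff_null_set) (auto simp: null_sets_def)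
  have fin: "emeasure lborel ?B < \<top>"
    using emeasure_lborel_cball_finite[of "0 :: 'a" 1] by (simp add: less_top)
  have "measure lborel ?B > 0"
    using content_cball_pos[of 1 "0 :: 'a"] by simp
  then have pos: "emeasure lborel ?B \<noteq> 0"
    by (metis enn2real_0 less_irrefl measure_def)
  have "emeasure (sphere_uniform :: 'a measure) (sphere 0 1) = emeasure lborel ?B / emeasure lborel ?B"
    by (simp only: emeasure_sphere_uniform[OF borel_closed[OF closed_sphere] order_refl] B diff)
  also have "\<dots> = 1"
    using fin pos by (rule ennreal_divide_self[rotated])
  finally show "emeasure (sphere_uniform :: 'a measure) (space sphere_uniform) = 1"
    by (simp only: space_sphere_uniform)
qed

end

theory Submission
  imports Defs
begin

text \<open>
  For a fixed direction \<open>\<theta>\<close>, the monotone matching of the projected rows is optimal (this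
  follows from explicit dual potentials), so the sliced cost is a minimum over permutations of
  quadratic functions of \<open>Y\<close>. If the rows of \<open>Y\<close> are distinct, then for almost every \<open>\<theta>\<close>
  their projections are distinct; a small perturbation of \<open>Y\<close> then keeps the optimal
  matching, and the cost is locally one of those quadratic functions. Optimality of the
  matchings bounds the first-order remainder by a multiple of the norm of the perturbation,
  and dominated convergence lets one differentiate under the integral. Since
  \<open>\<integral>\<theta>\<theta>\<^sup>T d\<sigma> = I/d\<close>, the \<open>k\<close>-th row of the gradient is
  \<open>2/(nd) (y\<^sub>k - \<Sum>\<^sub>l S\<^sub>k\<^sub>l z\<^sub>l)\<close>.
\<close>

section \<open>The uniform measure on the sphere\<close>

text \<open>\<open>sgn\<close> commutes with a norm-preserving linear map, so the cone over the
  preimage of \<open>A\<close> is the preimage of the cone over \<open>A\<close>. Invariance of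
  Lebesgue measure then passes to the cone measure.\<close>

lemma distr_sphere_uniform_eq:
  fixes T :: "'a::euclidean_space \<Rightarrow> 'a"
  assumes lin: "linear T" and norm: "\<And>x. norm (T x) = norm x"
    and lborel: "distr lborel borel T = lborel"
  shows "distr sphere_uniform sphere_uniform T = sphere_uniform"
proof (rule measure_eqI)
  fix A :: "'a set" assume "A \<in> sets (distr sphere_uniform sphere_uniform T)"
  then have A: "A \<in> sets borel" "A \<subseteq> sphere 0 1" and A': "A \<in> sets sphere_uniform"
    by (auto simp: sets_sphere_uniform sets_restrict_space_iff)
  have T [measurable]: "T \<in> borel_measurable borel"
    using lin by (intro borel_measurable_continuous_onI linear_continuous_on)
      (simp add: linear_conv_bounded_linear)
  have Tm: "T \<in> measurable sphere_uniform sphere_uniform"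
    unfolding sphere_uniform_def
    by (intro measurable_restrict_space3) (auto simp: norm)
  have sgn_T: "sgn (T x) = T (sgn x)" for x
    by (simp add: sgn_div_norm norm linear_cmul[OF lin])
  have sgn_meas: "sgn \<in> borel_measurable (borel :: 'a measure)"
    unfolding sgn_div_norm by measurable
  have meas: "{x \<in> cball 0 1. sgn x \<in> A} \<in> sets borel"
  proof -
    have "{x \<in> cball 0 1. sgn x \<in> A} = cball 0 1 \<inter> sgn -` A" by auto
    then show ?thesis using measurable_sets[OF sgn_meas A(1)] by simp
  qed
  have pre: "T -` A \<in> sets borel" "T -` A \<subseteq> sphere 0 1"
    using measurable_sets[OF T A(1)] A(2) norm by auto
  have "emeasure (distr sphere_uniform sphere_uniform T) A = emeasure sphere_uniform (T -` A)"
    using pre by (subst emeasure_distr[OF Tm A']) (auto simp: space_sphere_uniform Int_absorb2)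
  also have "\<dots> = emeasure lborel {x \<in> cball 0 1. sgn x \<in> T -` A} / emeasure lborel (cball 0 1 :: 'a set)"
    by (rule emeasure_sphere_uniform[OF pre])
  also have "{x \<in> cball 0 1. sgn x \<in> T -` A} = T -` {x \<in> cball 0 1. sgn x \<in> A}"
    by (auto simp: norm sgn_T)
  also have "emeasure lborel \<dots> = emeasure (distr lborel borel T) {x \<in> cball 0 1. sgn x \<in> A}"
    using meas by (simp add: emeasure_distr)
  also have "\<dots> / emeasure lborel (cball 0 1 :: 'a set) = emeasure sphere_uniform A"
    using A by (simp add: lborel emeasure_sphere_uniform)
  finally show "emeasure (distr sphere_uniform sphere_uniform T) A = emeasure sphere_uniform A" .
qed simp

lemma borel_measurable_sphere_uniform:
  "f \<in> borel_measurable borel \<Longrightarrow> f \<in> borel_measurable sphere_uniform"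
  unfolding sphere_uniform_def by (rule measurable_restrict_space1) simp

lemma integral_sphere_uniform_invariant:
  fixes T :: "'a::euclidean_space \<Rightarrow> 'a" and f :: "'a \<Rightarrow> real"
  assumes "linear T" and norm: "\<And>x. norm (T x) = norm x"
    and "distr lborel borel T = lborel" and f: "f \<in> borel_measurable borel"
  shows "(\<integral>x. f (T x) \<partial>sphere_uniform) = (\<integral>x. f x \<partial>sphere_uniform)"
proof -
  have "T \<in> borel_measurable borel"
    using assms(1) by (intro borel_measurable_continuous_onI linear_continuous_on)
      (simp add: linear_conv_bounded_linear)
  then have Tm: "T \<in> measurable sphere_uniform sphere_uniform"
    unfolding sphere_uniform_def
    by (intro measurable_restrict_space3) (auto simp: norm)
  show ?thesis
    using integral_distr[OF Tm borel_measurable_sphere_uniform[OF f]]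
    by (simp add: distr_sphere_uniform_eq[OF assms(1-3)])
qed

lemma integrable_sphere_uniform_inner:
  "integrable sphere_uniform (\<lambda>\<theta>::'a::euclidean_space. (\<theta> \<bullet> x) * (\<theta> \<bullet> y))"
proof -
  interpret prob_space "sphere_uniform :: 'a measure" by (rule prob_space_sphere_uniform)
  show ?thesis
  proof (rule integrable_const_bound)
    have "\<bar>(\<theta> \<bullet> x) * (\<theta> \<bullet> y)\<bar> \<le> norm x * norm y" if "norm \<theta> = 1" for \<theta>
      using Cauchy_Schwarz_ineq2[of \<theta> x] Cauchy_Schwarz_ineq2[of \<theta> y] that
      by (simp add: abs_mult mult_mono)
    then show "AE \<theta> in sphere_uniform. norm ((\<theta> \<bullet> x) * (\<theta> \<bullet> y)) \<le> norm x * norm y"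
      by (intro AE_I2) (simp add: space_sphere_uniform)
  qed (rule borel_measurable_sphere_uniform, measurable)
qed

section \<open>Coordinate symmetries and second moments\<close>

text \<open>Lebesgue measure is determined by its values on boxes. The preimage of a box is again a
  box, its sides permuted by the inverse \<open>q\<close> of \<open>p\<close>, and the product of
  the side lengths is unchanged.\<close>

lemma distr_lborel_permute:
  fixes p :: "'a::euclidean_space \<Rightarrow> 'a"
  assumes p: "bij_betw p Basis Basis"
  shows "distr lborel borel (\<lambda>x. \<Sum>b\<in>Basis. (x \<bullet> p b) *\<^sub>R b) = lborel" (is "distr _ _ ?T = _")
proof (rule lborel_eqI[symmetric])
  fix l u :: 'a assume le: "\<And>b. b \<in> Basis \<Longrightarrow> l \<bullet> b \<le> u \<bullet> b"
  define q where "q = inv_into Basis p"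
  have q: "bij_betw q Basis Basis" and pq: "\<And>b. b \<in> Basis \<Longrightarrow> p (q b) = b"
    and qp: "\<And>b. b \<in> Basis \<Longrightarrow> q (p b) = b"
    unfolding q_def using p by (auto simp: bij_betw_inv_into bij_betw_inv_into_right bij_betw_inv_into_left)
  have pB: "p b \<in> Basis" "q b \<in> Basis" if "b \<in> Basis" for b
    using that p q by (auto dest: bij_betwE)
  let ?S = "\<lambda>x. \<Sum>b\<in>Basis. (x \<bullet> q b) *\<^sub>R b"
  have [measurable]: "?T \<in> borel_measurable borel" by measurable
  have inT: "?T x \<bullet> b = x \<bullet> p b" and inS: "?S x \<bullet> b = x \<bullet> q b" if "b \<in> Basis" for x b
    using that by (simp_all add: inner_sum_left inner_Basis if_distrib sum.delta cong: if_cong)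
  have "?T -` box l u = box (?S l) (?S u)"
  proof (intro set_eqI)
    fix x
    have "x \<in> ?T -` box l u \<longleftrightarrow> (\<forall>b\<in>Basis. l \<bullet> b < x \<bullet> p b \<and> x \<bullet> p b < u \<bullet> b)"
      by (simp add: mem_box inT)
    also have "\<dots> \<longleftrightarrow> (\<forall>b\<in>Basis. l \<bullet> q b < x \<bullet> b \<and> x \<bullet> b < u \<bullet> q b)"
      using pq qp pB by metis
    also have "\<dots> \<longleftrightarrow> x \<in> box (?S l) (?S u)"
      by (simp add: mem_box inS)
    finally show "x \<in> ?T -` box l u \<longleftrightarrow> x \<in> box (?S l) (?S u)" .
  qed
  then have "emeasure (distr lborel borel ?T) (box l u) = emeasure lborel (box (?S l) (?S u))"
    by (simp add: emeasure_distr)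
  also have "\<dots> = ennreal (\<Prod>b\<in>Basis. (?S u - ?S l) \<bullet> b)"
    using le pB by (intro emeasure_lborel_box) (simp add: inS)
  also have "(\<Prod>b\<in>Basis. (?S u - ?S l) \<bullet> b) = (\<Prod>b\<in>Basis. (u - l) \<bullet> q b)"
    by (intro prod.cong refl) (simp add: inner_diff_left inS)
  also have "\<dots> = (\<Prod>b\<in>Basis. (u - l) \<bullet> b)"
    by (rule prod.reindex_bij_betw[OF q])
  finally show "emeasure (distr lborel borel ?T) (box l u) = (\<Prod>b\<in>Basis. (u - l) \<bullet> b)" .
qed simp

lemma integral_sphere_uniform_permute:
  fixes p :: "'a::euclidean_space \<Rightarrow> 'a"
  assumes p: "bij_betw p Basis Basis" and f: "f \<in> borel_measurable borel"
  shows "(\<integral>x. f (\<Sum>b\<in>Basis. (x \<bullet> p b) *\<^sub>R b) \<partial>sphere_uniform) = (\<integral>x. f x \<partial>sphere_uniform :: real)"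
proof (rule integral_sphere_uniform_invariant)
  let ?T = "\<lambda>x. \<Sum>b\<in>Basis. (x \<bullet> p b) *\<^sub>R b"
  show "linear ?T"
    by (intro linear_compose_sum ballI) (auto intro!: linearI simp: inner_add_left algebra_simps)
  show "norm (?T x) = norm x" for x
  proof -
    have "?T x \<bullet> ?T x = (\<Sum>b\<in>Basis. (x \<bullet> p b) * (x \<bullet> p b))"
      by (subst euclidean_inner) (simp add: inner_sum_left inner_Basis if_distrib sum.delta cong: if_cong)
    also have "\<dots> = (\<Sum>b\<in>Basis. (x \<bullet> b) * (x \<bullet> b))"
      by (rule sum.reindex_bij_betw[OF p])
    also have "\<dots> = x \<bullet> x"
      by (rule euclidean_inner[symmetric])
    finally show ?thesis by (simp add: norm_eq_sqrt_inner)
  qed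
qed (use f distr_lborel_permute[OF p] in auto)

lemma integral_sphere_uniform_reflect:
  fixes c :: "'a::euclidean_space" and f :: "'a \<Rightarrow> real"
  assumes c: "c \<in> Basis" and f: "f \<in> borel_measurable borel"
  shows "(\<integral>x. f (x - (2 * (x \<bullet> c)) *\<^sub>R c) \<partial>sphere_uniform) = (\<integral>x. f x \<partial>sphere_uniform)"
proof (rule integral_sphere_uniform_invariant)
  let ?T = "\<lambda>x. x - (2 * (x \<bullet> c)) *\<^sub>R c"
  let ?e = "\<lambda>b. if b = c then -1 else 1 :: real"
  show "linear ?T"
    by (rule linearI) (auto simp: inner_add_left algebra_simps)
  show "norm (?T x) = norm x" for x
  proof -
    have "?T x \<bullet> ?T x = x \<bullet> x"
      using c by (simp add: inner_diff_left inner_diff_right inner_commute algebra_simps)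
    then show ?thesis by (simp add: norm_eq_sqrt_inner)
  qed
  \<comment> \<open>The reflection is written as a diagonal scaling with entries 1 and -1, the form
    that \<open>lborel_affine_euclidean\<close> expects; the resulting density is the product of the
    absolute values, hence 1.\<close>
  have T: "?T x = 0 + (\<Sum>b\<in>Basis. (?e b * (x \<bullet> b)) *\<^sub>R b)" for x
  proof (rule euclidean_eqI)
    fix b :: 'a assume b: "b \<in> Basis"
    show "?T x \<bullet> b = (0 + (\<Sum>b\<in>Basis. (?e b * (x \<bullet> b)) *\<^sub>R b)) \<bullet> b"
      using b c by (cases "b = c")
        (simp_all add: inner_sum_left_Basis[OF b] inner_diff_left inner_not_same_Basis)
  qed
  have "(\<Prod>b\<in>Basis. \<bar>?e b\<bar>) = 1"
    by (rule prod.neutral) simp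
  then show "distr lborel borel ?T = lborel"
    using lborel_affine_euclidean[of ?e "0::'a"] by (simp add: density_1 T)
qed (rule f)

text \<open>For distinct \<open>b\<close> and \<open>c\<close>, reflecting in \<open>c\<close> shows
  that the integral equals its own negative. For \<open>b = c\<close>, coordinate swaps make all
  diagonal integrals equal, and they add up to the integral of the squared norm, which is 1.\<close>

lemma integral_sphere_uniform_Basis:
  fixes b c :: "'a::euclidean_space"
  assumes b: "b \<in> Basis" and c: "c \<in> Basis"
  shows "(\<integral>\<theta>. (\<theta> \<bullet> b) * (\<theta> \<bullet> c) \<partial>sphere_uniform) = (b \<bullet> c) / DIM('a)"
proof (cases "b = c")
  case False
  have "(\<integral>\<theta>. (\<theta> \<bullet> b) * (\<theta> \<bullet> c) \<partial>sphere_uniform)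
      = (\<integral>\<theta>. ((\<theta> - (2 * (\<theta> \<bullet> c)) *\<^sub>R c) \<bullet> b) * ((\<theta> - (2 * (\<theta> \<bullet> c)) *\<^sub>R c) \<bullet> c) \<partial>sphere_uniform)"
    by (rule integral_sphere_uniform_reflect[OF c, symmetric]) measurable
  also have "\<dots> = - (\<integral>\<theta>. (\<theta> \<bullet> b) * (\<theta> \<bullet> c) \<partial>sphere_uniform)"
    using b c False by (simp add: inner_diff_left inner_Basis)
  finally show ?thesis
    using b c False by (simp add: inner_Basis)
next
  case True
  have const: "(\<integral>\<theta>. (\<theta> \<bullet> e) * (\<theta> \<bullet> e) \<partial>sphere_uniform) = (\<integral>\<theta>. (\<theta> \<bullet> b) * (\<theta> \<bullet> b) \<partial>sphere_uniform)"
    if e: "e \<in> Basis" for e :: 'a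
  proof -
    let ?p = "Transposition.transpose b e"
    have p: "bij_betw ?p Basis Basis"
      using b e by (simp add: bij_betw_transpose_iff)
    have "(\<integral>\<theta>. (\<theta> \<bullet> b) * (\<theta> \<bullet> b) \<partial>sphere_uniform)
       = (\<integral>\<theta>. ((\<Sum>i\<in>Basis. (\<theta> \<bullet> ?p i) *\<^sub>R i) \<bullet> b) * ((\<Sum>i\<in>Basis. (\<theta> \<bullet> ?p i) *\<^sub>R i) \<bullet> b) \<partial>sphere_uniform)"
      by (rule integral_sphere_uniform_permute[OF p, symmetric]) measurable
    also have "\<dots> = (\<integral>\<theta>. (\<theta> \<bullet> e) * (\<theta> \<bullet> e) \<partial>sphere_uniform)"
      using b by (simp add: inner_sum_left inner_Basis if_distrib sum.delta cong: if_cong)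
    finally show ?thesis by simp
  qed
  interpret prob_space "sphere_uniform :: 'a measure" by (rule prob_space_sphere_uniform)
  have "real DIM('a) * (\<integral>\<theta>. (\<theta> \<bullet> b) * (\<theta> \<bullet> b) \<partial>sphere_uniform)
      = (\<Sum>e\<in>Basis. \<integral>\<theta>. (\<theta> \<bullet> e) * (\<theta> \<bullet> e) \<partial>(sphere_uniform :: 'a measure))"
    by (simp add: const)
  also have "\<dots> = (\<integral>\<theta>. (\<Sum>e\<in>Basis. (\<theta> \<bullet> e) * (\<theta> \<bullet> e)) \<partial>(sphere_uniform :: 'a measure))"
    by (rule Bochner_Integration.integral_sum[symmetric]) (rule integrable_sphere_uniform_inner)
  also have "\<dots> = (\<integral>\<theta>. 1 \<partial>(sphere_uniform :: 'a measure))"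
    by (intro Bochner_Integration.integral_cong refl)
      (auto simp: space_sphere_uniform norm_eq_1 euclidean_inner[symmetric])
  also have "\<dots> = 1" by (simp add: prob_space)
  finally show ?thesis using True b by (simp add: field_simps)
qed

lemma integral_sphere_uniform_inner:
  fixes x y :: "'a::euclidean_space"
  shows "(\<integral>\<theta>. (\<theta> \<bullet> x) * (\<theta> \<bullet> y) \<partial>sphere_uniform) = (x \<bullet> y) / DIM('a)"
proof -
  have "(\<theta> \<bullet> x) * (\<theta> \<bullet> y) = (\<Sum>b\<in>Basis. \<Sum>c\<in>Basis. (x \<bullet> b) * (y \<bullet> c) * ((\<theta> \<bullet> b) * (\<theta> \<bullet> c)))" for \<theta>
    by (subst (1 2) euclidean_inner) (simp add: sum_product mult_ac)
  then have "(\<integral>\<theta>. (\<theta> \<bullet> x) * (\<theta> \<bullet> y) \<partial>sphere_uniform)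
    = (\<Sum>b\<in>Basis. \<Sum>c\<in>Basis. (x \<bullet> b) * (y \<bullet> c) * ((b \<bullet> c) / DIM('a)))"
    by (simp add: integrable_sphere_uniform_inner Bochner_Integration.integral_sum
        integral_sphere_uniform_Basis)
  also have "\<dots> = (\<Sum>b\<in>Basis. (x \<bullet> b) * (y \<bullet> b)) / DIM('a)"
    by (simp add: inner_Basis if_distrib[of "\<lambda>r. r / _"] if_distrib[of "\<lambda>r. _ * r"]
        sum_divide_distrib cong: if_cong)
  finally show ?thesis by (simp flip: euclidean_inner)
qed

text \<open>The cone over the exceptional set lies in the hyperplane orthogonal to \<open>v\<close>,
  a Lebesgue null set. Applied to differences of rows, this makes projections of distinct rows
  distinct in almost every direction.\<close>

lemma AE_sphere_uniform_inner_nonzero: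
  fixes v :: "'a::euclidean_space"
  assumes "v \<noteq> 0"
  shows "AE \<theta> in sphere_uniform. \<theta> \<bullet> v \<noteq> 0"
proof -
  let ?N = "sphere 0 1 \<inter> {\<theta>. v \<bullet> \<theta> = 0}"
  have N: "?N \<in> sets borel" by (intro borel_closed closed_Int closed_sphere closed_hyperplane)
  have H: "{x. v \<bullet> x = 0} \<in> null_sets lborel"
    using negligible_hyperplane[of v 0] assms closed_hyperplane[of v 0]
    by (simp add: negligible_iff_null_sets null_sets_completion_iff)
  have "{x \<in> cball 0 1. sgn x \<in> ?N} \<subseteq> {x. v \<bullet> x = 0}"
    by (auto simp: sgn_div_norm)
  then have "emeasure lborel {x \<in> cball 0 1. sgn x \<in> ?N} \<le> emeasure lborel {x. v \<bullet> x = 0}"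
    by (rule emeasure_mono) simp
  then have "emeasure sphere_uniform ?N = 0"
    using H N by (simp add: emeasure_sphere_uniform null_sets_def)
  then show ?thesis
    by (intro AE_I[of _ _ ?N])
      (use N in \<open>auto simp: space_sphere_uniform sets_sphere_uniform sets_restrict_space_iff inner_commute\<close>)
qed

section \<open>Optimal transport between uniform measures on finitely many reals\<close>

abbreviation uniform_on_points :: "('n::finite \<Rightarrow> real) \<Rightarrow> real measure" where
  "uniform_on_points a \<equiv> distr (uniform_count_measure UNIV) borel a"

abbreviation transport_cost :: "real measure \<Rightarrow> real measure \<Rightarrow> ennreal" where
  "transport_cost \<mu> \<nu> \<equiv> INF \<pi>\<in>couplings \<mu> \<nu>. \<integral>\<^sup>+ (x, y). ennreal ((dist x y)\<^sup>2) \<partial>\<pi>"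

lemma W2_squared: "(W2 \<mu> \<nu>)\<^sup>2 = enn2real (transport_cost \<mu> \<nu>)"
  by (simp add: W2_def enn2real_nonneg)

lemma measurable_uniform_count_measure [measurable]:
  "space N = UNIV \<Longrightarrow> f \<in> measurable (uniform_count_measure UNIV) N"
  by (simp add: measurable_def space_uniform_count_measure sets_uniform_count_measure)

lemma distr_empirical_measure:
  "distr (empirical_measure Y) borel (line_proj \<theta>) = uniform_on_points (\<lambda>k. \<theta> \<bullet> Y $ k)"
proof -
  have "line_proj \<theta> \<in> borel_measurable borel"
    unfolding line_proj_def by simp
  then show ?thesis
    unfolding empirical_measure_def by (subst distr_distr) (auto simp: line_proj_def o_def)
qed

lemma distr_uniform_count_measure_bij:
  fixes p :: "'n::finite \<Rightarrow> 'n"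
  assumes "bij p"
  shows "distr (uniform_count_measure UNIV) (uniform_count_measure UNIV) p = uniform_count_measure UNIV"
proof (rule measure_eqI)
  fix A
  assume "A \<in> sets (distr (uniform_count_measure UNIV) (uniform_count_measure UNIV) p)"
  have "p \<in> measurable (uniform_count_measure UNIV) (uniform_count_measure UNIV)"
    by (simp add: space_uniform_count_measure)
  moreover have "card (p -` A) = card A"
    using assms by (simp add: card_vimage_inj bij_def)
  ultimately show "emeasure (distr (uniform_count_measure UNIV) (uniform_count_measure UNIV) p) A
      = emeasure (uniform_count_measure UNIV) A"
    by (simp add: emeasure_distr sets_uniform_count_measure space_uniform_count_measure
        emeasure_uniform_count_measure)
qed simp

lemma prob_space_uniform_count_measure_UNIV: "prob_space (uniform_count_measure (UNIV::'n::finite set))"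
  by (simp add: prob_space_uniform_count_measure)

text \<open>Pushing the uniform measure on indices forward along
  \<open>k \<mapsto> (a k, b (p k))\<close> gives a coupling. Its second marginal is the right one
  because a bijection preserves the uniform measure.\<close>

lemma transport_cost_le:
  fixes a b :: "'n::finite \<Rightarrow> real"
  assumes "bij p"
  shows "transport_cost (uniform_on_points a) (uniform_on_points b)
    \<le> ennreal ((\<Sum>k\<in>UNIV. (a k - b (p k))\<^sup>2) / real CARD('n))"
proof -
  let ?U = "uniform_count_measure (UNIV::'n set)"
  let ?g = "\<lambda>k. (a k, b (p k))"
  define \<pi> where "\<pi> = distr ?U (borel \<Otimes>\<^sub>M borel) ?g"
  have g: "?g \<in> measurable ?U (borel \<Otimes>\<^sub>M borel)"
    by (simp add: space_pair_measure)
  have "distr \<pi> (uniform_on_points a) fst = uniform_on_points a"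
    unfolding \<pi>_def by (subst distr_distr[OF _ g]) (auto simp: o_def intro!: distr_cong)
  moreover have "distr \<pi> (uniform_on_points b) snd = uniform_on_points b"
  proof -
    have "distr \<pi> (uniform_on_points b) snd = distr ?U borel (b \<circ> p)"
      unfolding \<pi>_def by (subst distr_distr[OF _ g]) (auto simp: o_def intro!: distr_cong)
    also have "\<dots> = distr (distr ?U ?U p) borel b"
      by (subst distr_distr) (auto simp: space_uniform_count_measure)
    finally show ?thesis
      using distr_uniform_count_measure_bij[OF assms] by simp
  qed
  moreover have "prob_space \<pi>"
    unfolding \<pi>_def by (rule prob_space.prob_space_distr[OF prob_space_uniform_count_measure_UNIV g])
  moreover have "sets \<pi> = sets (uniform_on_points a \<Otimes>\<^sub>M uniform_on_points b)"
    unfolding \<pi>_def by (simp cong: sets_pair_measure_cong)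
  ultimately have "\<pi> \<in> couplings (uniform_on_points a) (uniform_on_points b)"
    unfolding couplings_def by simp
  then have "transport_cost (uniform_on_points a) (uniform_on_points b)
      \<le> (\<integral>\<^sup>+ (x, y). ennreal ((dist x y)\<^sup>2) \<partial>\<pi>)"
    by (rule INF_lower)
  also have "\<dots> = (\<integral>\<^sup>+ k. ennreal ((a k - b (p k))\<^sup>2) \<partial>?U)"
    unfolding \<pi>_def by (subst nn_integral_distr[OF g]) (auto simp: dist_real_def)
  also have "\<dots> = ennreal ((\<Sum>k\<in>UNIV. (a k - b (p k))\<^sup>2) / real CARD('n))"
    by (simp add: uniform_count_measure_def nn_integral_point_measure_finite sum_divide_distrib
        flip: ennreal_mult' sum_ennreal)
  finally show ?thesis .
qed

text \<open>Discrete Legendre potentials: the piecewise affine convex \<open>\<phi>\<close> has slope \<open>b i\<close>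
  between \<open>a i\<close> and \<open>a (i + 1)\<close>.\<close>
lemma monotone_matching_potentials:
  fixes a b :: "nat \<Rightarrow> real"
  assumes a: "mono_on {1..n} a" and b: "mono_on {1..n} b" and "n > 0"
  obtains \<phi> \<psi> :: "real \<Rightarrow> real" where
    "\<phi> \<in> borel_measurable borel" "\<psi> \<in> borel_measurable borel"
    "\<And>i j. i \<in> {1..n} \<Longrightarrow> j \<in> {1..n} \<Longrightarrow> a i * b j \<le> \<phi> (a i) + \<psi> (b j)"
    "\<And>i. i \<in> {1..n} \<Longrightarrow> \<phi> (a i) + \<psi> (b i) = a i * b i"
proof -
  \<comment> \<open>\<open>f k\<close> is the value of the piecewise affine potential at
    \<open>a k\<close>, normalised by \<open>f 1 = 0\<close>; \<open>h k\<close> is the value of its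
    Legendre conjugate at \<open>b k\<close>.\<close>
  define f where "f k = (\<Sum>j=1..<k. b j * (a (Suc j) - a j))" for k
  define h where "h k = a k * b k - f k" for k
  have telescope: "(\<Sum>j=i..<k. a (Suc j) - a j) = a k - a i" if "i \<le> k" for i k
    using that by (rule sum_Suc_diff')
  have split: "f k = f i + (\<Sum>j=i..<k. b j * (a (Suc j) - a j))" if "1 \<le> i" "i \<le> k" for i k
    unfolding f_def using that by (simp add: sum.atLeastLessThan_concat)
  \<comment> \<open>The slope \<open>b i\<close> is a subgradient at \<open>a i\<close>: since
    \<open>b\<close> is monotone, the slopes to the right of \<open>a i\<close> are at least
    \<open>b i\<close> and those to the left at most \<open>b i\<close>.\<close>
  have subgrad: "b i * (a k - a i) \<le> f k - f i" if i: "i \<in> {1..n}" and k: "k \<in> {1..n}" for i k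
  proof (cases "i \<le> k")
    case True
    have "b i * (a k - a i) = (\<Sum>j=i..<k. b i * (a (Suc j) - a j))"
      using telescope[OF True] by (simp flip: sum_distrib_left)
    also have "\<dots> \<le> (\<Sum>j=i..<k. b j * (a (Suc j) - a j))"
      using i k True by (intro sum_mono mult_right_mono)
        (auto intro!: mono_onD[OF b] mono_onD[OF a])
    finally show ?thesis
      using split[of i k] i True by simp
  next
    case False
    then have "k \<le> i" by simp
    have "(\<Sum>j=k..<i. b j * (a (Suc j) - a j)) \<le> (\<Sum>j=k..<i. b i * (a (Suc j) - a j))"
      using i k by (intro sum_mono mult_right_mono)
        (auto intro!: mono_onD[OF b] mono_onD[OF a])
    also have "\<dots> = b i * (a i - a k)"
      using telescope[OF \<open>k \<le> i\<close>] by (simp flip: sum_distrib_left)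
    finally show ?thesis
      using split[of k i] k \<open>k \<le> i\<close> by (simp add: algebra_simps)
  qed
  \<comment> \<open>Maxima of finitely many affine functions are defined and Borel on the whole
    line, also when values of \<open>a\<close> or \<open>b\<close> coincide. By
    \<open>subgrad\<close>, the maximum at \<open>a k\<close> or \<open>b k\<close> is attained at
    index \<open>k\<close>.\<close>
  define \<phi> where "\<phi> x = Max ((\<lambda>i. b i * x - h i) ` {1..n})" for x
  define \<psi> where "\<psi> y = Max ((\<lambda>i. a i * y - f i) ` {1..n})" for y
  have \<phi>_a: "\<phi> (a k) = f k" if k: "k \<in> {1..n}" for k
    unfolding \<phi>_def
  proof (rule Max_eqI)
    show "y \<le> f k" if "y \<in> (\<lambda>i. b i * a k - h i) ` {1..n}" for y
      using that subgrad[OF _ k] by (force simp: h_def algebra_simps)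
    show "f k \<in> (\<lambda>i. b i * a k - h i) ` {1..n}"
      using k by (intro image_eqI[of _ _ k]) (auto simp: h_def)
  qed simp
  have \<psi>_b: "\<psi> (b k) = h k" if k: "k \<in> {1..n}" for k
    unfolding \<psi>_def
  proof (rule Max_eqI)
    show "y \<le> h k" if "y \<in> (\<lambda>i. a i * b k - f i) ` {1..n}" for y
      using that subgrad[OF k] by (force simp: h_def algebra_simps)
    show "h k \<in> (\<lambda>i. a i * b k - f i) ` {1..n}"
      using k by (intro image_eqI[of _ _ k]) (auto simp: h_def)
  qed simp
  show thesis
  proof
    show "\<phi> \<in> borel_measurable borel" "\<psi> \<in> borel_measurable borel"
      unfolding \<phi>_def[abs_def] \<psi>_def[abs_def] by (intro borel_measurable_Max; simp)+
    show "a i * b j \<le> \<phi> (a i) + \<psi> (b j)" if "i \<in> {1..n}" "j \<in> {1..n}" for i j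
      using subgrad[of j i] that by (simp add: \<phi>_a \<psi>_b h_def algebra_simps)
    show "\<phi> (a i) + \<psi> (b i) = a i * b i" if "i \<in> {1..n}" for i
      using that by (simp add: \<phi>_a \<psi>_b h_def)
  qed
qed

section \<open>Weak duality and the optimal cost\<close>

lemma integrable_uniform_on_points:
  fixes f :: "real \<Rightarrow> real"
  assumes "f \<in> borel_measurable borel"
  shows "integrable (uniform_on_points a) f"
  using assms
  by (subst integrable_distr_eq) (auto simp: uniform_count_measure_def integrable_point_measure_finite)

lemma integral_uniform_on_points:
  fixes f :: "real \<Rightarrow> real" and a :: "'n::finite \<Rightarrow> real"
  assumes "f \<in> borel_measurable borel"
  shows "integral\<^sup>L (uniform_on_points a) f = (\<Sum>k\<in>UNIV. f (a k)) / real CARD('n)"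
  using assms by (subst integral_distr) (auto simp: integral_uniform_count_measure)

lemma range_borel: "range (a :: 'n::finite \<Rightarrow> real) \<in> sets borel"
  by (intro borel_closed finite_imp_closed) simp

lemma AE_uniform_on_points: "AE x in uniform_on_points a. x \<in> range a"
  using range_borel[of a] by (subst AE_distr_iff) auto

text \<open>Kantorovich duality in its easy direction: \<open>F (x) + G (y)\<close> lies below the
  squared distance on the supports, with equality on matched pairs, and its integral against a
  coupling depends only on the marginals.\<close>

lemma transport_cost_ge:
  fixes a b :: "'n::finite \<Rightarrow> real"
  assumes s: "bij_betw s {1..CARD('n)} UNIV" and t: "bij_betw t {1..CARD('n)} UNIV"
    and a: "mono_on {1..CARD('n)} (a \<circ> s)" and b: "mono_on {1..CARD('n)} (b \<circ> t)"
  shows "ennreal ((\<Sum>i=1..CARD('n). (a (s i) - b (t i))\<^sup>2) / real CARD('n))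
    \<le> transport_cost (uniform_on_points a) (uniform_on_points b)"
proof (rule INF_greatest)
  let ?\<mu> = "uniform_on_points a" and ?\<nu> = "uniform_on_points b" and ?n = "CARD('n)"
  fix \<pi> assume "\<pi> \<in> couplings ?\<mu> ?\<nu>"
  then have sets: "sets \<pi> = sets (?\<mu> \<Otimes>\<^sub>M ?\<nu>)"
    and fst: "distr \<pi> ?\<mu> fst = ?\<mu>" and snd: "distr \<pi> ?\<nu> snd = ?\<nu>"
    by (auto simp: couplings_def)
  have m_fst: "fst \<in> measurable \<pi> ?\<mu>" and m_snd: "snd \<in> measurable \<pi> ?\<nu>"
    unfolding measurable_cong_sets[OF sets refl] by (rule measurable_fst measurable_snd)+
  obtain \<phi> \<psi> where [measurable]: "\<phi> \<in> borel_measurable borel" "\<psi> \<in> borel_measurable borel"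
    and le: "\<And>i j. i \<in> {1..?n} \<Longrightarrow> j \<in> {1..?n} \<Longrightarrow> a (s i) * b (t j) \<le> \<phi> (a (s i)) + \<psi> (b (t j))"
    and eq: "\<And>i. i \<in> {1..?n} \<Longrightarrow> \<phi> (a (s i)) + \<psi> (b (t i)) = a (s i) * b (t i)"
    using monotone_matching_potentials[OF a b] by (auto simp: o_def)
  \<comment> \<open>Subtracting twice the inequality \<open>x * y \<le> \<phi> x + \<psi> y\<close>
    from the sum of squares turns it into a lower bound for the squared distance.\<close>
  define F where "F x = x\<^sup>2 - 2 * \<phi> x" for x
  define G where "G y = y\<^sup>2 - 2 * \<psi> y" for y
  have F: "F \<in> borel_measurable borel" and G: "G \<in> borel_measurable borel"
    unfolding F_def[abs_def] G_def[abs_def] by measurable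
  have bound: "F (a k) + G (b l) \<le> (dist (a k) (b l))\<^sup>2" for k l
  proof -
    obtain i j where "i \<in> {1..?n}" "j \<in> {1..?n}" "k = s i" "l = t j"
      using s t by (metis UNIV_I bij_betw_imp_surj_on imageE)
    with le[of i j] show ?thesis
      by (simp add: F_def G_def dist_real_def power2_eq_square algebra_simps)
  qed
  \<comment> \<open>The dual inequality is available only at the points \<open>a k\<close> and
    \<open>b l\<close>; the marginal conditions force almost every point of the coupling to have
    such coordinates.\<close>
  have "AE z in \<pi>. fst z \<in> range a"
    using AE_uniform_on_points[of a] by (subst (asm) fst[symmetric], subst (asm) AE_distr_iff[OF m_fst]) (use range_borel in auto)
  moreover have "AE z in \<pi>. snd z \<in> range b"
    using AE_uniform_on_points[of b] by (subst (asm) snd[symmetric], subst (asm) AE_distr_iff[OF m_snd]) (use range_borel in auto)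
  ultimately have AE: "AE z in \<pi>. F (fst z) + G (snd z) \<le> (dist (fst z) (snd z))\<^sup>2"
    by eventually_elim (use bound in auto)
  have intF: "integrable \<pi> (\<lambda>z. F (fst z))"
    using integrable_uniform_on_points[OF F, of a] F m_fst
    by (subst (asm) fst[symmetric], subst (asm) integrable_distr_eq) auto
  have intG: "integrable \<pi> (\<lambda>z. G (snd z))"
    using integrable_uniform_on_points[OF G, of b] G m_snd
    by (subst (asm) snd[symmetric], subst (asm) integrable_distr_eq) auto
  have "(\<Sum>i=1..?n. (a (s i) - b (t i))\<^sup>2) = (\<Sum>i=1..?n. F (a (s i)) + G (b (t i)))"
  proof (intro sum.cong refl)
    fix i assume "i \<in> {1..?n}"
    from eq[OF this] show "(a (s i) - b (t i))\<^sup>2 = F (a (s i)) + G (b (t i))"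
      by (simp add: F_def G_def power2_eq_square algebra_simps)
  qed
  also have "\<dots> = (\<Sum>k\<in>UNIV. F (a k)) + (\<Sum>k\<in>UNIV. G (b k))"
    using sum.reindex_bij_betw[OF s, of "\<lambda>k. F (a k)"] sum.reindex_bij_betw[OF t, of "\<lambda>k. G (b k)"]
    by (simp add: sum.distrib)
  finally have "(\<Sum>i=1..?n. (a (s i) - b (t i))\<^sup>2) / real ?n = integral\<^sup>L ?\<mu> F + integral\<^sup>L ?\<nu> G"
    using integral_uniform_on_points[OF F, of a] integral_uniform_on_points[OF G, of b]
    by (simp add: add_divide_distrib)
  also have "integral\<^sup>L ?\<mu> F = (\<integral>z. F (fst z) \<partial>\<pi>)"
    using F by (subst fst[symmetric], subst integral_distr[OF m_fst]) auto
  also have "integral\<^sup>L ?\<nu> G = (\<integral>z. G (snd z) \<partial>\<pi>)"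
    using G by (subst snd[symmetric], subst integral_distr[OF m_snd]) auto
  also have "(\<integral>z. F (fst z) \<partial>\<pi>) + (\<integral>z. G (snd z) \<partial>\<pi>) = (\<integral>z. F (fst z) + G (snd z) \<partial>\<pi>)"
    using intF intG by simp
  \<comment> \<open>Only an inequality, because \<open>F + G\<close> may be negative and
    \<open>ennreal\<close> truncates its negative part.\<close>
  also have "\<dots> \<le> enn2real (\<integral>\<^sup>+z. ennreal (F (fst z) + G (snd z)) \<partial>\<pi>)"
    using Bochner_Integration.integrable_add[OF intF intG]
    by (subst real_lebesgue_integral_def) (auto simp: enn2real_nonneg)
  finally have "ennreal ((\<Sum>i=1..?n. (a (s i) - b (t i))\<^sup>2) / real ?n)
      \<le> ennreal (enn2real (\<integral>\<^sup>+z. ennreal (F (fst z) + G (snd z)) \<partial>\<pi>))"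
    by (rule ennreal_leI)
  \<comment> \<open>This holds even for an infinite integral, since \<open>enn2real\<close> sends
    infinity to 0.\<close>
  also have "\<dots> \<le> (\<integral>\<^sup>+z. ennreal (F (fst z) + G (snd z)) \<partial>\<pi>)"
    by (simp add: ennreal_enn2real_if)
  also have "\<dots> \<le> (\<integral>\<^sup>+z. ennreal ((dist (fst z) (snd z))\<^sup>2) \<partial>\<pi>)"
    using AE by (intro nn_integral_mono_AE) (auto intro: ennreal_leI)
  finally show "ennreal ((\<Sum>i=1..?n. (a (s i) - b (t i))\<^sup>2) / real ?n)
      \<le> (\<integral>\<^sup>+ (x, y). ennreal ((dist x y)\<^sup>2) \<partial>\<pi>)"
    by (simp add: case_prod_unfold)
qed

lemma W2_squared_le:
  fixes a b :: "'n::finite \<Rightarrow> real"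
  assumes "bij p"
  shows "(W2 (uniform_on_points a) (uniform_on_points b))\<^sup>2
    \<le> (\<Sum>k\<in>UNIV. (a k - b (p k))\<^sup>2) / real CARD('n)"
  using enn2real_mono[OF transport_cost_le[OF assms, of a b]]
  by (simp add: W2_squared sum_nonneg)

lemma W2_squared_sorted:
  fixes a b :: "'n::finite \<Rightarrow> real"
  assumes s: "bij_betw s {1..CARD('n)} UNIV" and t: "bij_betw t {1..CARD('n)} UNIV"
    and "mono_on {1..CARD('n)} (a \<circ> s)" and "mono_on {1..CARD('n)} (b \<circ> t)"
  shows "(W2 (uniform_on_points a) (uniform_on_points b))\<^sup>2
    = (\<Sum>k\<in>UNIV. (a k - b ((t \<circ> inv_into {1..CARD('n)} s) k))\<^sup>2) / real CARD('n)"
    (is "_ = ?R")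
proof (rule antisym)
  have p: "bij (t \<circ> inv_into {1..CARD('n)} s)"
    using bij_betw_trans[OF bij_betw_inv_into[OF s] t] .
  show "(W2 (uniform_on_points a) (uniform_on_points b))\<^sup>2 \<le> ?R"
    by (rule W2_squared_le[OF p])
  have "(\<Sum>i=1..CARD('n). (a (s i) - b (t i))\<^sup>2)
      = (\<Sum>k\<in>UNIV. (a k - b ((t \<circ> inv_into {1..CARD('n)} s) k))\<^sup>2)"
    by (subst sum.reindex_bij_betw[OF s, symmetric], rule sum.cong)
      (use s in \<open>auto simp: bij_betw_def inv_into_f_f\<close>)
  with transport_cost_ge[OF assms] have "ennreal ?R
      \<le> transport_cost (uniform_on_points a) (uniform_on_points b)"
    by simp
  \<comment> \<open>Finiteness has to be known before passing to reals: \<open>enn2real\<close> is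
    monotone only below a finite bound.\<close>
  moreover have "transport_cost (uniform_on_points a) (uniform_on_points b) < \<top>"
    using transport_cost_le[OF p, of a b] by (rule le_less_trans) simp
  ultimately have "enn2real (ennreal ?R)
      \<le> enn2real (transport_cost (uniform_on_points a) (uniform_on_points b))"
    by (rule enn2real_mono)
  then show "?R \<le> (W2 (uniform_on_points a) (uniform_on_points b))\<^sup>2"
    by (simp add: W2_squared sum_nonneg)
qed

section \<open>The gradient of the energy\<close>

definition sliced_cost :: "real^'d^'n \<Rightarrow> real^'d^'n \<Rightarrow> real^'d \<Rightarrow> real" where
  "sliced_cost Z X \<theta> = (W2 (uniform_on_points (\<lambda>k. \<theta> \<bullet> X $ k)) (uniform_on_points (\<lambda>k. \<theta> \<bullet> Z $ k)))\<^sup>2"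

definition matching ::
  "(real^'d \<Rightarrow> nat \<Rightarrow> 'n::finite) \<Rightarrow> (real^'d \<Rightarrow> nat \<Rightarrow> 'n) \<Rightarrow> real^'d \<Rightarrow> 'n \<Rightarrow> 'n" where
  "matching s t \<theta> = t \<theta> \<circ> inv_into {1..CARD('n)} (s \<theta>)"

lemma SW_energy_sliced_cost: "SW_energy Z X = (\<integral>\<theta>. sliced_cost Z X \<theta> \<partial>sphere_uniform)"
  by (simp add: SW_energy_def sliced_cost_def distr_empirical_measure)

lemma mono_on_sorting:
  assumes "measurable_sorting (X :: real^'d^'n) s" "\<theta> \<in> sphere 0 1"
  shows "mono_on {1..CARD('n)} ((\<lambda>k. \<theta> \<bullet> X $ k) \<circ> s \<theta>)"
  using assms by (auto simp: measurable_sorting_def line_proj_def intro!: mono_onI)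

lemma bij_betw_sorting:
  assumes "measurable_sorting (X :: real^'d^'n) s" "\<theta> \<in> sphere 0 1"
  shows "bij_betw (s \<theta>) {1..CARD('n)} UNIV"
  using assms by (auto simp: measurable_sorting_def)

lemma bij_matching:
  fixes X Z :: "real^'d^'n"
  assumes "measurable_sorting X s" "measurable_sorting Z t" "\<theta> \<in> sphere 0 1"
  shows "bij (matching s t \<theta>)"
  unfolding matching_def
  using bij_betw_trans[OF bij_betw_inv_into] bij_betw_sorting assms by blast

text \<open>The conditions on \<open>s\<close> concern the single direction \<theta>. A sorting of
  \<open>Y\<close> can therefore be used for a perturbed matrix \<open>Y + H\<close> whenever it
  still sorts the projections in that direction.\<close>

lemma sliced_cost_sorted:
  fixes X Z :: "real^'d^'n"
  assumes "bij_betw (s \<theta>) {1..CARD('n)} UNIV" "mono_on {1..CARD('n)} ((\<lambda>k. \<theta> \<bullet> X $ k) \<circ> s \<theta>)"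
    and "measurable_sorting Z t" "\<theta> \<in> sphere 0 1"
  shows "sliced_cost Z X \<theta> = (\<Sum>k\<in>UNIV. (\<theta> \<bullet> X $ k - \<theta> \<bullet> Z $ matching s t \<theta> k)\<^sup>2) / real CARD('n)"
  unfolding sliced_cost_def matching_def
  using W2_squared_sorted[OF assms(1) bij_betw_sorting[OF assms(3,4)] assms(2) mono_on_sorting[OF assms(3,4)]] .

lemma sliced_cost_matching:
  fixes X Z :: "real^'d^'n"
  assumes "measurable_sorting X s" "measurable_sorting Z t" "\<theta> \<in> sphere 0 1"
  shows "sliced_cost Z X \<theta> = (\<Sum>k\<in>UNIV. (\<theta> \<bullet> X $ k - \<theta> \<bullet> Z $ matching s t \<theta> k)\<^sup>2) / real CARD('n)"
  using sliced_cost_sorted bij_betw_sorting mono_on_sorting assms by blast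

lemma sliced_cost_le:
  fixes X Z :: "real^'d^'n"
  assumes "bij p"
  shows "sliced_cost Z X \<theta> \<le> (\<Sum>k\<in>UNIV. (\<theta> \<bullet> X $ k - \<theta> \<bullet> Z $ p k)\<^sup>2) / real CARD('n)"
  unfolding sliced_cost_def by (rule W2_squared_le[OF assms])

lemma match_region_eq: "match_region s t k l = {\<theta> \<in> sphere 0 1. matching s t \<theta> k = l}"
  by (simp add: match_region_def matching_def)

text \<open>Row \<open>k\<close> is matched to row \<open>l\<close> exactly when both occupy a
  common position \<open>i\<close> in the two sorted lists. This is a finite union of intersections
  of level sets of the measurable sortings.\<close>

lemma sets_match_region:
  fixes Y Z :: "real^'d^'n"
  assumes s: "measurable_sorting Y s" and t: "measurable_sorting Z t"
  shows "match_region s t k l \<in> sets sphere_uniform"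
proof -
  let ?pre = "\<lambda>u i k. (\<lambda>\<theta>. u \<theta> i) -` {k} \<inter> space (sphere_uniform :: (real^'d) measure)"
  have "match_region s t k l = (\<Union>i\<in>{1..CARD('n)}. ?pre s i k \<inter> ?pre t i l)"
  proof (intro set_eqI iffI)
    fix \<theta> assume "\<theta> \<in> match_region s t k l"
    then have \<theta>: "\<theta> \<in> sphere 0 1" and l: "t \<theta> (inv_into {1..CARD('n)} (s \<theta>) k) = l"
      by (auto simp: match_region_def)
    have k: "k \<in> s \<theta> ` {1..CARD('n)}"
      using bij_betw_sorting[OF s \<theta>] by (simp add: bij_betw_def)
    show "\<theta> \<in> (\<Union>i\<in>{1..CARD('n)}. ?pre s i k \<inter> ?pre t i l)"
      using \<theta> l inv_into_into[OF k] f_inv_into_f[OF k] by (auto simp: space_sphere_uniform)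
  next
    fix \<theta> assume "\<theta> \<in> (\<Union>i\<in>{1..CARD('n)}. ?pre s i k \<inter> ?pre t i l)"
    then obtain i where i: "i \<in> {1..CARD('n)}" "s \<theta> i = k" "t \<theta> i = l" and \<theta>: "\<theta> \<in> sphere 0 1"
      by (auto simp: space_sphere_uniform)
    have "inv_into {1..CARD('n)} (s \<theta>) k = i"
      using bij_betw_sorting[OF s \<theta>] i by (auto simp: bij_betw_def inv_into_f_f)
    with i \<theta> show "\<theta> \<in> match_region s t k l"
      by (simp add: match_region_def)
  qed
  moreover have "?pre s i k \<inter> ?pre t i l \<in> sets sphere_uniform" if "i \<in> {1..CARD('n)}" for i
  proof -
    have "(\<lambda>\<theta>. s \<theta> i) \<in> measurable sphere_uniform (count_space UNIV)"
      "(\<lambda>\<theta>. t \<theta> i) \<in> measurable sphere_uniform (count_space UNIV)"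
      using s t that by (auto simp: measurable_sorting_def)
    then show ?thesis
      by (intro sets.Int measurable_sets[of _ _ "count_space UNIV"]) auto
  qed
  ultimately show ?thesis
    by (simp add: sets.finite_UN)
qed

lemma measurable_matching:
  fixes Y Z :: "real^'d^'n"
  assumes "measurable_sorting Y s" "measurable_sorting Z t"
  shows "(\<lambda>\<theta>. matching s t \<theta> k) \<in> measurable sphere_uniform (count_space UNIV)"
proof -
  have "(\<lambda>\<theta>. matching s t \<theta> k) -` {l} \<inter> space sphere_uniform = match_region s t k l" for l
    by (auto simp: match_region_eq space_sphere_uniform)
  then show ?thesis
    using sets_match_region[OF assms, of k] by (simp add: measurable_count_space_eq2)
qed

lemma borel_measurable_sphere_uniform_inner [measurable]:
  "(\<lambda>\<theta>. \<theta> \<bullet> x) \<in> borel_measurable (sphere_uniform :: 'a::euclidean_space measure)"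
  by (rule borel_measurable_sphere_uniform) measurable

lemma borel_measurable_inner_matching:
  fixes Y Z :: "real^'d^'n"
  assumes "measurable_sorting Y s" "measurable_sorting Z t"
  shows "(\<lambda>\<theta>. \<theta> \<bullet> Z $ matching s t \<theta> k) \<in> borel_measurable sphere_uniform"
  by (rule measurable_compose_countable'[where f = "\<lambda>l \<theta>. \<theta> \<bullet> Z $ l" and I = UNIV])
    (use measurable_matching[OF assms] in \<open>auto intro: countable_finite\<close>)

lemma abs_inner_row_le:
  fixes X :: "real^'d^'n"
  assumes "\<theta> \<in> sphere 0 1"
  shows "\<bar>\<theta> \<bullet> X $ k\<bar> \<le> norm X"
proof -
  have "\<bar>\<theta> \<bullet> X $ k\<bar> \<le> norm (X $ k)"
    using Cauchy_Schwarz_ineq2[of \<theta> "X $ k"] assms by simp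
  also have "\<dots> \<le> norm X"
    by (rule Finite_Cartesian_Product.norm_nth_le)
  finally show ?thesis .
qed

lemma mean_le:
  fixes f :: "'n::finite \<Rightarrow> real"
  assumes "\<And>k. f k \<le> c"
  shows "(\<Sum>k\<in>UNIV. f k) / real CARD('n) \<le> c"
  using sum_bounded_above[of UNIV f c] assms by (simp add: divide_le_eq mult.commute)

text \<open>Measurability in \<theta> is not visible from the infimum over couplings; it comes from
  the formula with the measurable matching, which agrees with the cost on the sphere. The cost is
  bounded there.\<close>

lemma integrable_sliced_cost:
  fixes X Z :: "real^'d^'n"
  assumes s: "measurable_sorting X s" and t: "measurable_sorting Z t"
  shows "integrable sphere_uniform (sliced_cost Z X)"
proof -
  interpret prob_space "sphere_uniform :: (real^'d) measure" by (rule prob_space_sphere_uniform)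
  note [measurable] = borel_measurable_inner_matching[OF s t]
  show ?thesis
  proof (rule integrable_const_bound)
    show "AE \<theta> in sphere_uniform. norm (sliced_cost Z X \<theta>) \<le> (norm X + norm Z)\<^sup>2"
    proof (rule AE_I2)
      fix \<theta> :: "real^'d" assume "\<theta> \<in> space sphere_uniform"
      then have \<theta>: "\<theta> \<in> sphere 0 1" by (simp add: space_sphere_uniform)
      have "(\<theta> \<bullet> X $ k - \<theta> \<bullet> Z $ matching s t \<theta> k)\<^sup>2 \<le> (norm X + norm Z)\<^sup>2" for k
        using abs_inner_row_le[OF \<theta>, of X k] abs_inner_row_le[OF \<theta>, of Z "matching s t \<theta> k"]
        by (intro power2_le_iff_abs_le[THEN iffD2]) auto
      from mean_le[of "\<lambda>k. (\<theta> \<bullet> X $ k - \<theta> \<bullet> Z $ matching s t \<theta> k)\<^sup>2", OF this]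
      show "norm (sliced_cost Z X \<theta>) \<le> (norm X + norm Z)\<^sup>2"
        using sliced_cost_matching[OF s t \<theta>] by (simp add: sum_nonneg)
    qed
    have "(\<lambda>\<theta>. (\<Sum>k\<in>UNIV. (\<theta> \<bullet> X $ k - \<theta> \<bullet> Z $ matching s t \<theta> k)\<^sup>2) / real CARD('n))
        \<in> borel_measurable sphere_uniform"
      by measurable
    then show "sliced_cost Z X \<in> borel_measurable sphere_uniform"
      by (rule measurable_cong[THEN iffD1, rotated])
        (simp add: sliced_cost_matching[OF s t] space_sphere_uniform)
  qed
qed

section \<open>First-order expansion in a fixed direction\<close>

text \<open>The derivative at \<open>Y\<close> in direction \<open>H\<close> of the quadratic cost
  in which the matching \<open>m \<theta>\<close> is held fixed.\<close>

definition sliced_differential ::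
  "(real^'d \<Rightarrow> 'n \<Rightarrow> 'n) \<Rightarrow> real^'d^'n \<Rightarrow> real^'d^'n \<Rightarrow> real^'d^'n \<Rightarrow> real^'d \<Rightarrow> real" where
  "sliced_differential m Z Y H \<theta> =
    2 * (\<Sum>k\<in>UNIV. (\<theta> \<bullet> Y $ k - \<theta> \<bullet> Z $ m \<theta> k) * (\<theta> \<bullet> H $ k)) / real CARD('n)"

text \<open>The second-order term does not involve \<open>m\<close>, so expansions with different
  matchings differ only in their zeroth and first-order terms.\<close>

lemma quadratic_cost_expansion:
  fixes Y Z H :: "real^'d^'n"
  shows "(\<Sum>k\<in>UNIV. (\<theta> \<bullet> (Y + H) $ k - \<theta> \<bullet> Z $ m \<theta> k)\<^sup>2) / real CARD('n) =
    (\<Sum>k\<in>UNIV. (\<theta> \<bullet> Y $ k - \<theta> \<bullet> Z $ m \<theta> k)\<^sup>2) / real CARD('n) + sliced_differential m Z Y H \<theta>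
    + (\<Sum>k\<in>UNIV. (\<theta> \<bullet> H $ k)\<^sup>2) / real CARD('n)"
proof -
  have "(\<theta> \<bullet> (Y + H) $ k - \<theta> \<bullet> Z $ m \<theta> k)\<^sup>2 = (\<theta> \<bullet> Y $ k - \<theta> \<bullet> Z $ m \<theta> k)\<^sup>2
      + 2 * ((\<theta> \<bullet> Y $ k - \<theta> \<bullet> Z $ m \<theta> k) * (\<theta> \<bullet> H $ k)) + (\<theta> \<bullet> H $ k)\<^sup>2" for k
    by (simp add: inner_add_right power2_eq_square algebra_simps)
  then show ?thesis
    by (simp add: sliced_differential_def sum.distrib add_divide_distrib sum_distrib_left)
qed

lemma mean_square_le:
  fixes H :: "real^'d^'n"
  assumes "\<theta> \<in> sphere 0 1"
  shows "(\<Sum>k\<in>UNIV. (\<theta> \<bullet> H $ k)\<^sup>2) / real CARD('n) \<le> (norm H)\<^sup>2"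
  by (rule mean_le) (use abs_inner_row_le[OF assms] in \<open>simp add: power2_le_iff_abs_le\<close>)

text \<open>The upper bound tests the cost at \<open>Y + H\<close> with the matching of \<open>Y\<close>, the lower bound
  tests the cost at \<open>Y\<close> with the matching of \<open>Y + H\<close>.\<close>
lemma sliced_cost_remainder_bound:
  fixes Y Z H :: "real^'d^'n"
  assumes s: "measurable_sorting Y s" and s': "measurable_sorting (Y + H) s'"
    and t: "measurable_sorting Z t" and \<theta>: "\<theta> \<in> sphere 0 1"
  shows "\<bar>sliced_cost Z (Y + H) \<theta> - sliced_cost Z Y \<theta> - sliced_differential (matching s t) Z Y H \<theta>\<bar>
    \<le> (4 * norm Z + norm H) * norm H"
proof -
  let ?m = "matching s t" and ?m' = "matching s' t"
  let ?L = "sliced_differential ?m Z Y H \<theta>" and ?L' = "sliced_differential ?m' Z Y H \<theta>"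
  let ?Q = "(\<Sum>k\<in>UNIV. (\<theta> \<bullet> H $ k)\<^sup>2) / real CARD('n)"
  have "sliced_cost Z (Y + H) \<theta> \<le> sliced_cost Z Y \<theta> + ?L + ?Q"
    using sliced_cost_le[OF bij_matching[OF s t \<theta>], of Z "Y + H" \<theta>]
    unfolding quadratic_cost_expansion sliced_cost_matching[OF s t \<theta>] .
  moreover have "?Q \<le> norm H * norm H"
    using mean_square_le[OF \<theta>, of H] by (simp add: power2_eq_square)
  moreover have "0 \<le> norm Z * norm H" by simp
  ultimately have upper: "sliced_cost Z (Y + H) \<theta> - sliced_cost Z Y \<theta> - ?L \<le> (4 * norm Z + norm H) * norm H"
    unfolding distrib_right mult.assoc by linarith
  have "sliced_cost Z (Y + H) \<theta> \<ge> sliced_cost Z Y \<theta> + ?L' + ?Q"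
    using sliced_cost_le[OF bij_matching[OF s' t \<theta>], of Z Y \<theta>]
    unfolding quadratic_cost_expansion sliced_cost_matching[OF s' t \<theta>] by simp
  moreover have "0 \<le> ?Q" by (simp add: sum_nonneg)
  \<comment> \<open>The terms in \<open>Y\<close> cancel. Two projected rows of \<open>Z\<close>
    differ by at most \<open>2 * norm Z\<close>, and the factor 2 of the differential yields the
    constant 4.\<close>
  moreover have "?L - ?L' \<le> 4 * norm Z * norm H"
  proof -
    have "?L - ?L' = (\<Sum>k\<in>UNIV. 2 * ((\<theta> \<bullet> Z $ ?m' \<theta> k - \<theta> \<bullet> Z $ ?m \<theta> k) * (\<theta> \<bullet> H $ k))) / real CARD('n)"
      unfolding sliced_differential_def diff_divide_distrib[symmetric] sum_distrib_left sum_subtractf[symmetric]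
      by (simp add: algebra_simps)
    also have "\<dots> \<le> 4 * norm Z * norm H"
    proof (rule mean_le)
      fix k
      have "\<bar>\<theta> \<bullet> Z $ ?m' \<theta> k - \<theta> \<bullet> Z $ ?m \<theta> k\<bar> \<le> 2 * norm Z"
        using abs_inner_row_le[OF \<theta>, of Z "?m' \<theta> k"] abs_inner_row_le[OF \<theta>, of Z "?m \<theta> k"] by linarith
      then have "\<bar>(\<theta> \<bullet> Z $ ?m' \<theta> k - \<theta> \<bullet> Z $ ?m \<theta> k) * (\<theta> \<bullet> H $ k)\<bar> \<le> 2 * norm Z * norm H"
        unfolding abs_mult using abs_inner_row_le[OF \<theta>, of H k] by (intro mult_mono) auto
      then show "2 * ((\<theta> \<bullet> Z $ ?m' \<theta> k - \<theta> \<bullet> Z $ ?m \<theta> k) * (\<theta> \<bullet> H $ k)) \<le> 4 * norm Z * norm H"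
        by linarith
    qed
    finally show ?thesis .
  qed
  moreover have "0 \<le> norm H * norm H" by simp
  ultimately have "- ((4 * norm Z + norm H) * norm H) \<le> sliced_cost Z (Y + H) \<theta> - sliced_cost Z Y \<theta> - ?L"
    unfolding distrib_right by linarith
  with upper show ?thesis by linarith
qed

text \<open>Strict inequalities between the projections of \<open>Y\<close> survive small
  perturbations, so the sorting of \<open>Y\<close> also sorts \<open>Y + H\<close>. The remainder
  is then the mean square of the projections of \<open>H\<close>, and its quotient by
  \<open>norm H\<close> is at most \<open>norm H\<close>.\<close>

lemma sliced_cost_differentiable_pointwise:
  fixes Y Z :: "real^'d^'n"
  assumes s: "measurable_sorting Y s" and t: "measurable_sorting Z t" and \<theta>: "\<theta> \<in> sphere 0 1"
    and distinct: "\<And>i j. i \<noteq> j \<Longrightarrow> \<theta> \<bullet> Y $ i \<noteq> \<theta> \<bullet> Y $ j"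
  shows "((\<lambda>H. (sliced_cost Z (Y + H) \<theta> - sliced_cost Z Y \<theta>
    - sliced_differential (matching s t) Z Y H \<theta>) / norm H) \<longlongrightarrow> 0) (at 0)"
proof -
  note sorted = mono_on_sorting[OF s \<theta>] and bij = bij_betw_sorting[OF s \<theta>]
  have "eventually (\<lambda>H. i \<le> j \<longrightarrow> \<theta> \<bullet> (Y + H) $ s \<theta> i \<le> \<theta> \<bullet> (Y + H) $ s \<theta> j) (at 0)"
    if i: "i \<in> {1..CARD('n)}" and j: "j \<in> {1..CARD('n)}" for i j
  proof (cases "i < j")
    case True
    have "inj_on (s \<theta>) {1..CARD('n)}"
      using bij by (rule bij_betw_imp_inj_on)
    then have "s \<theta> i \<noteq> s \<theta> j"
      using i j True by (auto dest: inj_onD)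
    moreover have "\<theta> \<bullet> Y $ s \<theta> i \<le> \<theta> \<bullet> Y $ s \<theta> j"
      using mono_onD[OF sorted i j] True by simp
    ultimately have "\<theta> \<bullet> Y $ s \<theta> i < \<theta> \<bullet> Y $ s \<theta> j"
      using distinct by (simp add: less_le)
    moreover have "((\<lambda>H. \<theta> \<bullet> (Y + H) $ s \<theta> j - \<theta> \<bullet> (Y + H) $ s \<theta> i)
        \<longlongrightarrow> \<theta> \<bullet> (Y + 0) $ s \<theta> j - \<theta> \<bullet> (Y + 0) $ s \<theta> i) (at 0)"
      by (intro tendsto_intros)
    ultimately have "eventually (\<lambda>H. 0 < \<theta> \<bullet> (Y + H) $ s \<theta> j - \<theta> \<bullet> (Y + H) $ s \<theta> i) (at 0)"
      by (intro order_tendstoD(1)) auto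
    then show ?thesis by eventually_elim simp
  next
    case False
    then show ?thesis by (auto simp: le_less)
  qed
  then have "eventually (\<lambda>H. \<forall>i\<in>{1..CARD('n)}. \<forall>j\<in>{1..CARD('n)}.
      i \<le> j \<longrightarrow> \<theta> \<bullet> (Y + H) $ s \<theta> i \<le> \<theta> \<bullet> (Y + H) $ s \<theta> j) (at 0)"
    by (intro eventually_ball_finite ballI) simp_all
  then have "eventually (\<lambda>H. norm ((sliced_cost Z (Y + H) \<theta> - sliced_cost Z Y \<theta>
    - sliced_differential (matching s t) Z Y H \<theta>) / norm H) \<le> norm H) (at 0)"
  proof eventually_elim
    case (elim H)
    then have "mono_on {1..CARD('n)} ((\<lambda>k. \<theta> \<bullet> (Y + H) $ k) \<circ> s \<theta>)"
      by (auto intro!: mono_onI)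
    \<comment> \<open>With the same sorting on both sides the matchings agree, and the zeroth and
      first-order terms cancel exactly.\<close>
    from sliced_cost_sorted[where s = s and X = "Y + H", OF bij this t \<theta>]
    have "sliced_cost Z (Y + H) \<theta> - sliced_cost Z Y \<theta> - sliced_differential (matching s t) Z Y H \<theta>
        = (\<Sum>k\<in>UNIV. (\<theta> \<bullet> H $ k)\<^sup>2) / real CARD('n)"
      unfolding quadratic_cost_expansion sliced_cost_matching[OF s t \<theta>] by simp
    moreover have "(\<Sum>k\<in>UNIV. (\<theta> \<bullet> H $ k)\<^sup>2) / real CARD('n) \<le> norm H * norm H"
      using mean_square_le[OF \<theta>, of H] by (simp add: power2_eq_square)
    moreover have "0 \<le> (\<Sum>k\<in>UNIV. (\<theta> \<bullet> H $ k)\<^sup>2) / real CARD('n)"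
      by (simp add: sum_nonneg)
    ultimately have "\<bar>sliced_cost Z (Y + H) \<theta> - sliced_cost Z Y \<theta>
        - sliced_differential (matching s t) Z Y H \<theta>\<bar> \<le> norm H * norm H"
      by linarith
    then show ?case
      by (cases "H = 0") (simp_all add: pos_divide_le_eq)
  qed
  moreover have "((\<lambda>H::real^'d^'n. norm H) \<longlongrightarrow> 0) (at 0)"
    by (intro tendsto_norm_zero tendsto_ident_at)
  ultimately show ?thesis
    by (rule Lim_null_comparison)
qed

section \<open>Integrating the differential over the sphere\<close>

lemma outer_product_mult_inner:
  fixes \<theta> z h :: "real^'d"
  shows "((\<chi> i j. \<theta> $ i * \<theta> $ j) *v z) \<bullet> h = (\<theta> \<bullet> z) * (\<theta> \<bullet> h)"
proof -
  have "((\<chi> i j. \<theta> $ i * \<theta> $ j) *v z) = (\<theta> \<bullet> z) *\<^sub>R \<theta>"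
    by (simp add: vec_eq_iff matrix_vector_mult_def inner_vec_def sum_distrib_left mult_ac)
  then show ?thesis by simp
qed

lemma integrable_outer_product:
  "integrable (sphere_uniform :: (real^'d) measure) (\<lambda>\<theta>. (\<chi> i j. \<theta> $ i * \<theta> $ j) :: real^'d^'d)"
proof -
  \<comment> \<open>\<open>axis i (axis j 1)\<close> is the matrix unit at position
    \<open>(i, j)\<close>. Expanding the outer product in these units reduces integrability of a
    matrix-valued function to that of scalar products.\<close>
  have entry: "((\<theta> \<bullet> axis i 1) * (\<theta> \<bullet> axis j 1)) *\<^sub>R axis i (axis j 1) $ a $ b
      = (if j = b then if i = a then \<theta> $ a * \<theta> $ b else 0 else (0::real))" for \<theta> :: "real^'d" and i j a b :: 'd
    by (simp add: inner_axis) (simp add: axis_def)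
  have outer: "(\<lambda>\<theta>::real^'d. (\<chi> i j. \<theta> $ i * \<theta> $ j) :: real^'d^'d) =
      (\<lambda>\<theta>. \<Sum>i\<in>UNIV. \<Sum>j\<in>UNIV. ((\<theta> \<bullet> axis i 1) * (\<theta> \<bullet> axis j 1)) *\<^sub>R axis i (axis j 1))"
    by (simp only: fun_eq_iff vec_eq_iff sum_component vec_lambda_beta vector_scaleR_component entry) simp
  show ?thesis
    unfolding outer
    by (rule Bochner_Integration.integrable_sum)+
      (rule integrable_scaleR_left, rule integrable_sphere_uniform_inner)
qed

text \<open>The map \<open>M \<mapsto> (M *v z) \<bullet> h\<close> is bounded linear, hence
  commutes with the matrix-valued integral.\<close>

lemma match_matrix_mult_inner:
  fixes Y Z :: "real^'d^'n"
  assumes "measurable_sorting Y s" "measurable_sorting Z t"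
  shows "(match_matrix s t k l *v z) \<bullet> h
    = real CARD('d) * (\<integral>\<theta>. indicator (match_region s t k l) \<theta> * ((\<theta> \<bullet> z) * (\<theta> \<bullet> h)) \<partial>sphere_uniform)"
proof -
  let ?A = "match_region s t k l"
  have "linear (\<lambda>M :: real^'d^'d. (M *v z) \<bullet> h)"
    by (rule linearI)
      (simp_all add: matrix_vector_mult_add_rdistrib inner_add_left flip: scaleR_matrix_vector_assoc)
  then have bl: "bounded_linear (\<lambda>M :: real^'d^'d. (M *v z) \<bullet> h)"
    by (simp add: linear_conv_bounded_linear)
  have "integrable sphere_uniform (\<lambda>\<theta>. indicator ?A \<theta> *\<^sub>R ((\<chi> i j. \<theta> $ i * \<theta> $ j) :: real^'d^'d))"
    by (rule integrable_mult_indicator[OF sets_match_region[OF assms] integrable_outer_product])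
  from integral_bounded_linear[OF bl this] show ?thesis
    by (simp add: match_matrix_def set_lebesgue_integral_def outer_product_mult_inner
        flip: scaleR_matrix_vector_assoc)
qed

lemma sliced_differential_integral:
  fixes Y Z H :: "real^'d^'n"
  assumes s: "measurable_sorting Y s" and t: "measurable_sorting Z t"
  defines "G \<equiv> (\<chi> k. (2 / (real CARD('n) * real CARD('d))) *\<^sub>R
    (Y $ k - (\<Sum>l\<in>UNIV. match_matrix s t k l *v (Z $ l))))"
  shows "integrable sphere_uniform (sliced_differential (matching s t) Z Y H)" (is ?int)
    and "(\<integral>\<theta>. sliced_differential (matching s t) Z Y H \<theta> \<partial>sphere_uniform) = H \<bullet> G" (is ?eq)
proof -
  let ?ind = "\<lambda>k l \<theta>. indicator (match_region s t k l) \<theta> * ((\<theta> \<bullet> Z $ l) * (\<theta> \<bullet> H $ k))"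
  \<comment> \<open>\<open>F\<close> replaces the row index depending on \<theta> by a sum over all
    \<open>l\<close> weighted with indicators. For fixed \<open>k\<close> the regions partition the
    sphere, so exactly one weight is 1, and every summand has a fixed row of
    \<open>Z\<close>.\<close>
  define F where "F \<theta> = 2 * (\<Sum>k\<in>UNIV. (\<theta> \<bullet> Y $ k) * (\<theta> \<bullet> H $ k) - (\<Sum>l\<in>UNIV. ?ind k l \<theta>)) / real CARD('n)"
    for \<theta>
  have ind: "integrable sphere_uniform (?ind k l)" for k l
    using integrable_mult_indicator[OF sets_match_region[OF s t] integrable_sphere_uniform_inner]
    by (simp only: real_scaleR_def)
  have int_term: "integrable sphere_uniform (\<lambda>\<theta>. (\<theta> \<bullet> Y $ k) * (\<theta> \<bullet> H $ k) - (\<Sum>l\<in>UNIV. ?ind k l \<theta>))" for k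
    by (intro Bochner_Integration.integrable_diff Bochner_Integration.integrable_sum ind
        integrable_sphere_uniform_inner)
  have intF: "integrable sphere_uniform F"
    unfolding F_def[abs_def]
    by (intro integrable_divide_zero integrable_mult_right Bochner_Integration.integrable_sum int_term)
  have eqF: "sliced_differential (matching s t) Z Y H \<theta> = F \<theta>" if "\<theta> \<in> space sphere_uniform" for \<theta>
  proof -
    have "(\<Sum>l\<in>UNIV. ?ind k l \<theta>) = (\<theta> \<bullet> Z $ matching s t \<theta> k) * (\<theta> \<bullet> H $ k)" for k
      using that by (simp add: match_region_eq indicator_def space_sphere_uniform
          if_distrib[of "\<lambda>r. r * _"] cong: if_cong)
    then show ?thesis
      by (simp add: F_def sliced_differential_def left_diff_distrib)
  qed
  show ?int
  proof -
    have "integrable sphere_uniform (sliced_differential (matching s t) Z Y H)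
        \<longleftrightarrow> integrable sphere_uniform F"
      by (rule Bochner_Integration.integrable_cong) (simp_all add: eqF)
    with intF show ?thesis by simp
  qed
  have int_ind: "(\<integral>\<theta>. ?ind k l \<theta> \<partial>sphere_uniform) = (match_matrix s t k l *v Z $ l) \<bullet> H $ k / real CARD('d)" for k l
    using match_matrix_mult_inner[OF s t, of k l "Z $ l" "H $ k"] by simp
  have "(\<integral>\<theta>. sliced_differential (matching s t) Z Y H \<theta> \<partial>sphere_uniform) = integral\<^sup>L sphere_uniform F"
    by (intro Bochner_Integration.integral_cong refl eqF)
  also have "\<dots> = 2 * (\<Sum>k\<in>UNIV. \<integral>\<theta>. (\<theta> \<bullet> Y $ k) * (\<theta> \<bullet> H $ k) - (\<Sum>l\<in>UNIV. ?ind k l \<theta>) \<partial>sphere_uniform) / real CARD('n)"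
    unfolding F_def[abs_def] by (simp only: integral_divide_zero integral_mult_right_zero
        Bochner_Integration.integral_sum[OF int_term])
  \<comment> \<open>The second moments give \<open>Y $ k\<close> the factor \<open>1/d\<close>; the
    terms in \<open>Z\<close> get the same factor by undoing the \<open>d\<close> built into
    \<open>match_matrix\<close>.\<close>
  also have "\<dots> = 2 * (\<Sum>k\<in>UNIV. Y $ k \<bullet> H $ k / real CARD('d) - (\<Sum>l\<in>UNIV. (match_matrix s t k l *v Z $ l) \<bullet> H $ k / real CARD('d))) / real CARD('n)"
    by (simp only: Bochner_Integration.integral_diff[OF integrable_sphere_uniform_inner
          Bochner_Integration.integrable_sum[OF ind]] Bochner_Integration.integral_sum[OF ind]
        int_ind integral_sphere_uniform_inner DIM_cart DIM_real mult_1_right)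
  also have "\<dots> = H \<bullet> G"
    by (simp add: G_def inner_vec_def[of H] inner_diff_right inner_sum_right inner_commute mult.commute
        sum_distrib_left sum_divide_distrib diff_divide_distrib right_diff_distrib)
  finally show ?eq .
qed

section \<open>Differentiation under the integral\<close>

text \<open>A sorting is supposed for every matrix because integrability of the perturbed cost and
  the remainder bound use one for \<open>Y + H\<close>.\<close>

proposition GDERIV_SW_energy:
  fixes Y Z :: "real^'d^'n"
  assumes \<tau>: "\<And>X. measurable_sorting X (\<tau> X)" and Y: "Y \<in> distinct_rows"
  shows "GDERIV (SW_energy Z) Y :> (\<chi> k. (2 / (real CARD('n) * real CARD('d))) *\<^sub>R
    (Y $ k - (\<Sum>l\<in>UNIV. match_matrix (\<tau> Y) (\<tau> Z) k l *v (Z $ l))))" (is "GDERIV _ _ :> ?G")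
proof -
  let ?L = "sliced_differential (matching (\<tau> Y) (\<tau> Z)) Z Y"
  define R where "R H \<theta> = (sliced_cost Z (Y + H) \<theta> - sliced_cost Z Y \<theta> - ?L H \<theta>) / norm H" for H \<theta>
  note diff = sliced_differential_integral[OF \<tau>[of Y] \<tau>[of Z]]
  interpret prob_space "sphere_uniform :: (real^'d) measure" by (rule prob_space_sphere_uniform)
  have intR: "integrable sphere_uniform (R H)" for H
    unfolding R_def[abs_def]
    by (intro integrable_divide_zero Bochner_Integration.integrable_diff
        integrable_sliced_cost[OF \<tau> \<tau>] diff(1))
  have remainder: "(SW_energy Z (Y + H) - SW_energy Z Y - H \<bullet> ?G) / norm H = integral\<^sup>L sphere_uniform (R H)" for H
    unfolding R_def[abs_def]
    by (simp add: SW_energy_sliced_cost diff(2)[symmetric] integrable_sliced_cost[OF \<tau> \<tau>] diff(1))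
  \<comment> \<open>At \<open>H = 0\<close> division by zero makes the quotient 0, so the bound
    holds there as well.\<close>
  have bound: "\<bar>R H \<theta>\<bar> \<le> 4 * norm Z + norm H" if "\<theta> \<in> sphere 0 1" for H \<theta>
    using sliced_cost_remainder_bound[OF \<tau> \<tau> \<tau> that, of Z Y H]
    by (cases "H = 0") (simp_all add: R_def divide_le_eq)
  have "AE \<theta> in sphere_uniform. \<forall>ij\<in>{ij. fst ij \<noteq> snd ij}. \<theta> \<bullet> (Y $ fst ij - Y $ snd ij) \<noteq> 0"
    using Y by (intro AE_finite_allI) (auto simp: distinct_rows_def intro!: AE_sphere_uniform_inner_nonzero)
  then have "AE \<theta> in sphere_uniform. \<forall>i j. i \<noteq> j \<longrightarrow> \<theta> \<bullet> Y $ i \<noteq> \<theta> \<bullet> Y $ j"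
    by eventually_elim (auto simp: inner_diff_right)
  then have pointwise: "AE \<theta> in sphere_uniform. ((\<lambda>H. R H \<theta>) \<longlongrightarrow> 0) (at 0)"
    using AE_space
  proof eventually_elim
    case (elim \<theta>)
    then show ?case
      unfolding R_def
      by (intro sliced_cost_differentiable_pointwise[OF \<tau> \<tau>]) (auto simp: space_sphere_uniform)
  qed
  have "((\<lambda>H. integral\<^sup>L sphere_uniform (R H)) \<longlongrightarrow> 0) (at 0)"
    \<comment> \<open>Dominated convergence applies to sequences, so the limit is tested along
      sequences of nonzero matrices tending to 0. Such a sequence is bounded by some
      \<open>K\<close>, and the constant \<open>4 * norm Z + K\<close> dominates.\<close>
    unfolding tendsto_at_iff_sequentially comp_def
  proof (intro allI impI)
    fix X :: "nat \<Rightarrow> real^'d^'n"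
    assume X: "\<forall>i. X i \<in> UNIV - {0}" "X \<longlonglongrightarrow> 0"
    obtain K where K: "\<And>i. norm (X i) \<le> K"
      using convergent_imp_Bseq[of X] X(2) by (auto simp: convergent_def Bseq_def)
    have "(\<lambda>i. integral\<^sup>L sphere_uniform (R (X i))) \<longlonglongrightarrow> (\<integral>\<theta>. 0 \<partial>(sphere_uniform :: (real^'d) measure))"
    proof (rule integral_dominated_convergence)
      show "AE \<theta> in sphere_uniform. (\<lambda>i. R (X i) \<theta>) \<longlonglongrightarrow> 0"
        using pointwise by eventually_elim (use X in \<open>auto simp: tendsto_at_iff_sequentially comp_def\<close>)
      show "AE \<theta> in sphere_uniform. norm (R (X i) \<theta>) \<le> 4 * norm Z + K" for i
        using bound[of _ "X i"] K[of i] by (intro AE_I2) (force simp: space_sphere_uniform)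
      show "integrable sphere_uniform (\<lambda>\<theta>::real^'d. 4 * norm Z + K)" by simp
      show "(\<lambda>\<theta>::real^'d. 0) \<in> borel_measurable sphere_uniform" by simp
      show "R (X i) \<in> borel_measurable sphere_uniform" for i
        using intR by (rule borel_measurable_integrable)
    qed
    then show "(\<lambda>i. integral\<^sup>L sphere_uniform (R (X i))) \<longlonglongrightarrow> 0" by simp
  qed
  then have "((\<lambda>H. \<bar>(SW_energy Z (Y + H) - SW_energy Z Y - H \<bullet> ?G) / norm H\<bar>) \<longlongrightarrow> 0) (at 0)"
    unfolding remainder by (rule tendsto_rabs_zero)
  then show ?thesis
    unfolding gderiv_def has_derivative_at by (simp add: bounded_linear_inner_left)
qed

theorem corollary3p1:
  fixes Y Z :: "real^'d^'n"
    and \<tau> :: "real^'d^'n \<Rightarrow> real^'d \<Rightarrow> nat \<Rightarrow> 'n"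
  assumes "\<And>X. measurable_sorting X (\<tau> X)"
    and "Y \<in> distinct_rows"
  shows "critical_point (SW_energy Z) Y \<longleftrightarrow>
    (\<forall>k. Y $ k = (\<Sum>l\<in>UNIV. match_matrix (\<tau> Y) (\<tau> Z) k l *v (Z $ l)))"
proof -
  let ?G = "\<chi> k. (2 / (real CARD('n) * real CARD('d))) *\<^sub>R
    (Y $ k - (\<Sum>l\<in>UNIV. match_matrix (\<tau> Y) (\<tau> Z) k l *v (Z $ l)))"
  have G: "GDERIV (SW_energy Z) Y :> ?G"
    using assms by (rule GDERIV_SW_energy)
  have "critical_point (SW_energy Z) Y \<longleftrightarrow> ?G = 0"
  proof
    assume "critical_point (SW_energy Z) Y"
    with G have "(\<lambda>h. h \<bullet> ?G) = (\<lambda>h. h \<bullet> 0)"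
      unfolding critical_point_def gderiv_def by (rule has_derivative_unique)
    \<comment> \<open>Evaluating the two equal derivatives at the gradient itself gives that its
      squared norm is 0.\<close>
    from fun_cong[OF this, of ?G] show "?G = 0"
      by (simp only: inner_zero_right inner_eq_zero_iff)
  next
    assume "?G = 0"
    with G show "critical_point (SW_energy Z) Y"
      unfolding critical_point_def by (rule GDERIV_subst)
  qed
  \<comment> \<open>The scalar factor in each row of the gradient is nonzero, so the gradient
    vanishes exactly when every bracket does.\<close>
  also have "\<dots> \<longleftrightarrow> (\<forall>k. Y $ k = (\<Sum>l\<in>UNIV. match_matrix (\<tau> Y) (\<tau> Z) k l *v (Z $ l)))"
    unfolding vec_eq_iff by (intro all_cong1) simp
  finally show ?thesis .
qed

end
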